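(* Let $m>1$ be an integer and let $\mathcal A(m)$ be the set of all $m$-extensions. The map $\mu:\mathcal A(m)\to\mathbb N^{m-1}$, $A\mapsto {\rm Kunz}^p(A)$, is surjective; that is, for every $(k_1,\dots,k_{m-1})\in\mathbb N^{m-1}$ there exists an $m$-extension $A$ with ${\rm Kunz}^p(A)=(k_1,\dots,k_{m-1})$.
   Context: $\mathbb N$ is the set of positive integers, $\mathbb N_0=\mathbb N\cup\{0\}$, and $[a,b]=\{x\in\mathbb Z: a\le x\le b\}$. For an integer $m>1$, an $m$-extension is a finite set $A\subset\mathbb N$ containing $[1,m-1]$ that admits a partition $A=A_0\cup A_1\cup\dots\cup A_t$ for some $t\in\mathbb N_0$, where $A_0=[1,m-1]$ and $A_{i+1}\subseteq m+A_i$ for all $i$. The pseudo Kunz coordinates: for $i\in[1,m-1]$ let $w_i=m+\max\{a\in A: a\equiv i\pmod m\}$ and write $w_i=mk_i+i$; then ${\rm Kunz}^p(A)=(k_1,\dots,k_{m-1})$. *)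

theory Defs
  imports
    "HOL-Library.FuncSet"
    "HOL-Library.Disjoint_Sets"
    "HOL-Number_Theory.Cong"
begin

definition m_extension :: "nat \<Rightarrow> nat set \<Rightarrow> bool" where
  "m_extension m A \<longleftrightarrow>
     finite A \<and> A \<subseteq> {1..} \<and> {1..m - 1} \<subseteq> A \<and>
     (\<exists>(t::nat) (B :: nat \<Rightarrow> nat set).
        A = (\<Union>i\<le>t. B i) \<and> disjoint_family_on B {..t} \<and> (\<forall>i\<le>t. B i \<noteq> {}) \<and>
        B 0 = {1..m - 1} \<and> (\<forall>i<t. B (Suc i) \<subseteq> (\<lambda>a. m + a) ` B i))"

definition m_extensions :: "nat \<Rightarrow> nat set set" where
  "m_extensions m = {A. m_extension m A}"

definition kunz_w :: "nat \<Rightarrow> nat set \<Rightarrow> nat \<Rightarrow> nat" where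
  "kunz_w m A i = m + Max {a \<in> A. [a = i] (mod m)}"

text \<open>The tuple \<open>(k\<^sub>1, \<dots>, k\<^bsub>m-1\<^esub>)\<close> is encoded as a function on \<open>{1..m - 1}\<close>, extended by
  \<open>undefined\<close> outside, so that equality of functions is equality of tuples.\<close>

definition pseudo_kunz :: "nat \<Rightarrow> nat set \<Rightarrow> (nat \<Rightarrow> nat)" where
  "pseudo_kunz m A = (\<lambda>i\<in>{1..m - 1}. THE k. kunz_w m A i = m * k + i)"

end

theory Submission
  imports Defs
begin

text \<open>The tuple \<open>k\<close> is attained by the staircase set whose layer \<open>j\<close> consists of the \<open>m * j + i\<close>
  with \<open>j < k i\<close>: the largest element congruent to \<open>i\<close> is \<open>m * (k i - 1) + i\<close>.\<close>

text \<open>Membership of \<open>i\<close> in \<open>{1..m - 1}\<close> forces \<open>m > 0\<close>,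
  so \<open>m * c + i\<close> determines \<open>c\<close> and the \<open>THE\<close> has a unique
  solution.\<close>

lemma pseudo_kunz_eq:
  assumes "kunz_w m A i = m * c + i" "i \<in> {1..m - 1}"
  shows "pseudo_kunz m A i = c"
  using assms by (auto simp: pseudo_kunz_def)

text \<open>The maximum has remainder \<open>i\<close> because \<open>i < m\<close>; the extra
  \<open>m\<close> in \<open>kunz_w\<close> raises its quotient by one, hence
  \<open>c \<ge> 1\<close>.\<close>

lemma kunz_w_decomp:
  assumes "finite A" "i \<in> A" "i < m"
  shows "\<exists>c\<ge>1. kunz_w m A i = m * c + i"
proof -
  let ?S = "{a \<in> A. [a = i] (mod m)}"
  have "Max ?S \<in> ?S"
    using assms by (intro Max_in) auto
  then have "Max ?S mod m = i"
    using assms(3) by (simp add: cong_def)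
  then have "Max ?S = m * (Max ?S div m) + i"
    by (metis mult_div_mod_eq)
  then have "kunz_w m A i = m * Suc (Max ?S div m) + i"
    unfolding kunz_w_def by (metis add.assoc mult_Suc_right)
  then show ?thesis
    by (intro exI[of _ "Suc (Max ?S div m)"]) simp
qed

lemma pseudo_kunz_in_PiE:
  assumes "m_extension m A"
  shows "pseudo_kunz m A \<in> {1..m - 1} \<rightarrow>\<^sub>E {1..}"
proof (rule PiE_I)
  fix i assume i: "i \<in> {1..m - 1}"
  then have "finite A" "i \<in> A" "i < m"
    using assms by (auto simp: m_extension_def)
  then obtain c where "c \<ge> 1" "kunz_w m A i = m * c + i"
    using kunz_w_decomp by blast
  then show "pseudo_kunz m A i \<in> {1..}"
    using pseudo_kunz_eq[OF _ i] by (metis atLeast_iff)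
qed (auto simp: pseudo_kunz_def)

definition staircase_layer :: "nat \<Rightarrow> (nat \<Rightarrow> nat) \<Rightarrow> nat \<Rightarrow> nat set" where
  "staircase_layer m k j = (\<lambda>i. m * j + i) ` {i \<in> {1..m - 1}. j < k i}"

definition staircase :: "nat \<Rightarrow> (nat \<Rightarrow> nat) \<Rightarrow> nat set" where
  "staircase m k = (\<Union>j. staircase_layer m k j)"

lemma staircase_layer_div:
  "a \<in> staircase_layer m k j \<Longrightarrow> a div m = j"
  by (auto simp: staircase_layer_def)

lemma m_extension_staircase:
  assumes "m > 1" and pos: "\<And>i. i \<in> {1..m - 1} \<Longrightarrow> k i \<ge> 1"
  shows "m_extension m (staircase m k)"
proof -
  let ?B = "staircase_layer m k"
  \<comment> \<open>Layer \<open>j\<close> is nonempty exactly when \<open>j < K\<close>, so the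
    partition ends at index \<open>t = K - 1\<close>.\<close>
  define K where "K = Max (k ` {1..m - 1})"
  have "K \<in> k ` {1..m - 1}"
    unfolding K_def using assms(1) by (intro Max_in) auto
  then obtain i0 where i0: "i0 \<in> {1..m - 1}" "k i0 = K"
    by auto
  \<comment> \<open>Without this, truncated subtraction would break the passage from
    \<open>j \<le> K - 1\<close> to \<open>j < K\<close>.\<close>
  have K_pos: "K \<ge> 1"
    using pos i0 by force
  have le_K: "k i \<le> K" if "i \<in> {1..m - 1}" for i
    unfolding K_def using that by simp
  have B0: "?B 0 = {1..m - 1}"
    using pos by (force simp: staircase_layer_def)
  have union: "staircase m k = (\<Union>j\<le>K - 1. ?B j)"
    unfolding staircase_def staircase_layer_def using le_K by fastforce
  have "?B j \<noteq> {}" if "j \<le> K - 1" for j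
    using that i0 K_pos by (auto simp: staircase_layer_def)
  moreover have "disjoint_family_on ?B {..K - 1}"
    unfolding disjoint_family_on_def using staircase_layer_div by blast
  \<comment> \<open>\<open>Suc j < k i\<close> implies \<open>j < k i\<close>, so subtracting
    \<open>m\<close> stays in the column of \<open>i\<close>.\<close>
  moreover have "?B (Suc j) \<subseteq> (\<lambda>a. m + a) ` ?B j" for j
    by (force simp: staircase_layer_def)
  moreover have "finite (staircase m k)"
    unfolding union by (simp add: staircase_layer_def)
  moreover have "staircase m k \<subseteq> {1..}"
    by (auto simp: staircase_def staircase_layer_def)
  moreover have "{1..m - 1} \<subseteq> staircase m k"
    unfolding staircase_def B0[symmetric] by blast
  ultimately show ?thesis
    unfolding m_extension_def using B0 union by blast
qed

lemma kunz_w_staircase: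
  assumes i: "i \<in> {1..m - 1}" and "k i \<ge> 1"
  shows "kunz_w m (staircase m k) i = m * k i + i"
proof -
  \<comment> \<open>Distinct elements of \<open>{1..m - 1}\<close> are incongruent modulo
    \<open>m\<close>, so only the column of \<open>i\<close> survives.\<close>
  have "{a \<in> staircase m k. [a = i] (mod m)} = (\<lambda>j. m * j + i) ` {..<k i}"
    using i by (auto simp: staircase_def staircase_layer_def cong_def)
  moreover have "Max ((\<lambda>j. m * j + i) ` {..<k i}) = m * (k i - 1) + i"
    using assms(2) by (intro Max_eqI) auto
  ultimately show ?thesis
    using assms(2) by (cases "k i") (simp_all add: kunz_w_def)
qed

theorem theorem3p4:
  fixes m :: nat
  assumes "m > 1"
  shows "pseudo_kunz m ` m_extensions m = ({1..m - 1} \<rightarrow>\<^sub>E {1..})"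
proof (rule antisym)
  show "pseudo_kunz m ` m_extensions m \<subseteq> ({1..m - 1} \<rightarrow>\<^sub>E {1..})"
    unfolding m_extensions_def using pseudo_kunz_in_PiE by blast
next
  show "({1..m - 1} \<rightarrow>\<^sub>E {1..}) \<subseteq> pseudo_kunz m ` m_extensions m"
  proof
    fix k :: "nat \<Rightarrow> nat"
    assume k: "k \<in> {1..m - 1} \<rightarrow>\<^sub>E {1..}"
    then have pos: "k i \<ge> 1" if "i \<in> {1..m - 1}" for i
      using that PiE_mem by fastforce
    have ext: "m_extension m (staircase m k)"
      using assms pos by (rule m_extension_staircase)
    have "pseudo_kunz m (staircase m k) = k"
      using pseudo_kunz_in_PiE[OF ext] k
      \<comment> \<open>Both functions are \<open>undefined\<close> off \<open>{1..m - 1}\<close>,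
        so agreement on that set gives equality.\<close>
      by (rule PiE_ext) (metis pseudo_kunz_eq kunz_w_staircase pos)
    then show "k \<in> pseudo_kunz m ` m_extensions m"
      using ext unfolding m_extensions_def by (metis imageI mem_Collect_eq)
  qed
qed

end
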